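(* Let $d\in\{2,3\}$. There exists a universal constant $C_{\mathrm{eq}}>0$, depending exclusively on $d$, such that for every (non-degenerate) simplex $K\subset\mathbb R^d$ and all affine vector-valued functions $\mathbf f,\mathbf g\in\mathbb P_1(K)^d$, $$\big\|\,|\mathbf f|\,\mathbf f+\mathbf g\,\big\|_{0,K}\le C_{\mathrm{eq}}\,\big\|\,b_K^{1/2}\big(|\mathbf f|\,\mathbf f+\mathbf g\big)\big\|_{0,K}.$$
   Context: $\|\cdot\|_{0,K}$ is the $L^2(K)$ norm (of vector fields), $|\cdot|$ the Euclidean norm in $\mathbb R^d$, and $\mathbb P_1(K)$ the polynomials of total degree at most one on $K$. The volume-bubble function $b_K\in W^{1,\infty}_0(K)$ on a simplex $K\subset\mathbb R^d$ is $(d+1)^{d+1}$ times the product of all $d+1$ barycentric coordinates of $K$, so that $0\le b_K\le1=\max_Kb_K$. *)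

theory Defs
  imports "HOL-Analysis.Analysis"
begin

definition vertices :: "'a::real_vector set \<Rightarrow> 'a set"
  where "vertices K = {v. v extreme_point_of K}"

(* barycentric K x v is the coordinate of x belonging to the vertex v.  The coordinates are
   required to vanish off the vertices so that they are unique as a function on the whole type;
   see barycentric_ex1 and barycentric_eqI. *)
definition barycentric :: "(real^'n) set \<Rightarrow> real^'n \<Rightarrow> real^'n \<Rightarrow> real"
  where "barycentric K x = (THE u. (\<forall>v. v \<notin> vertices K \<longrightarrow> u v = 0) \<and>
           (\<Sum>v\<in>vertices K. u v) = 1 \<and> (\<Sum>v\<in>vertices K. u v *\<^sub>R v) = x)"

(* The volume bubble.  It is only used for arguments in K; the product polynomial is not
   truncated to 0 outside K. *)
definition bubble :: "(real^'n) set \<Rightarrow> real^'n \<Rightarrow> real"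
  where "bubble K x = real (CARD('n) + 1) ^ (CARD('n) + 1) * (\<Prod>v\<in>vertices K. barycentric K x v)"

definition P1 :: "(real^'n) set \<Rightarrow> (real^'n \<Rightarrow> real) set"
  where "P1 K = {p. \<exists>c a. \<forall>x\<in>K. p x = c + (\<Sum>j\<in>UNIV. a j * x $ j)}"

definition P1_vec :: "(real^'n) set \<Rightarrow> (real^'n \<Rightarrow> real^'n) set"
  where "P1_vec K = {f. \<forall>i. (\<lambda>x. f x $ i) \<in> P1 K}"

(* As a Bochner integral this would be 0 for a field that is not square integrable on K;
   the statement only applies it to fields that are continuous on a compact set. *)
definition L2_norm_on :: "(real^'n) set \<Rightarrow> (real^'n \<Rightarrow> real^'n) \<Rightarrow> real"
  where "L2_norm_on K f = sqrt (LINT x:K|lebesgue. (norm (f x))\<^sup>2)"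

lemma vertices_convex_hull:
  fixes C :: "'a::euclidean_space set"
  assumes "\<not> affine_dependent C"
  shows "vertices (convex hull C) = C"
  using assms by (auto simp: vertices_def extreme_point_of_convex_hull_affine_independent)

lemma simplex_vertices:
  fixes K :: "(real^'n) set"
  assumes "int CARD('n) simplex K"
  shows "finite (vertices K)" "card (vertices K) = CARD('n) + 1"
    "\<not> affine_dependent (vertices K)" "K = convex hull (vertices K)"
proof -
  obtain C where "finite C" "\<not> affine_dependent C" "int (card C) = int CARD('n) + 1"
    "K = convex hull C"
    using assms unfolding simplex by blast
  moreover from this have "vertices K = C" using vertices_convex_hull by blast
  ultimately show "finite (vertices K)" "card (vertices K) = CARD('n) + 1"
    "\<not> affine_dependent (vertices K)" "K = convex hull (vertices K)"
    by auto
qed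

lemma barycentric_ex1:
  fixes K :: "(real^'n) set"
  assumes "int CARD('n) simplex K"
  shows "\<exists>!u. (\<forall>v. v \<notin> vertices K \<longrightarrow> u v = 0) \<and>
           (\<Sum>v\<in>vertices K. u v) = 1 \<and> (\<Sum>v\<in>vertices K. u v *\<^sub>R v) = x"
proof -
  note S = simplex_vertices[OF assms]
  have "affine hull (vertices K) = UNIV"
    using S by (intro affine_independent_span_gt) auto
  then obtain u where u: "sum u (vertices K) = 1" "(\<Sum>v\<in>vertices K. u v *\<^sub>R v) = x"
    using affine_hull_finite[OF S(1)] by auto
  define w where "w = (\<lambda>v. if v \<in> vertices K then u v else 0)"
  have w: "sum w (vertices K) = 1" "(\<Sum>v\<in>vertices K. w v *\<^sub>R v) = x"
    "\<forall>v. v \<notin> vertices K \<longrightarrow> w v = 0"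
    using u by (auto simp: w_def cong: sum.cong)
  have "u1 = u2"
    if 1: "\<forall>v. v \<notin> vertices K \<longrightarrow> u1 v = 0" "sum u1 (vertices K) = 1"
          "(\<Sum>v\<in>vertices K. u1 v *\<^sub>R v) = x"
      and 2: "\<forall>v. v \<notin> vertices K \<longrightarrow> u2 v = 0" "sum u2 (vertices K) = 1"
          "(\<Sum>v\<in>vertices K. u2 v *\<^sub>R v) = x" for u1 u2
  proof -
    have "sum (\<lambda>v. u1 v - u2 v) (vertices K) = 0"
      "(\<Sum>v\<in>vertices K. (u1 v - u2 v) *\<^sub>R v) = 0"
      using 1 2 by (simp_all add: sum_subtractf scaleR_diff_left)
    then have "\<forall>v\<in>vertices K. u1 v - u2 v = 0"
      using S(3) affine_dependent_explicit_finite[OF S(1)] by auto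
    then show ?thesis
      using 1(1) 2(1) by (metis eq_iff_diff_eq_0 ext)
  qed
  with w show ?thesis by blast
qed

lemma barycentric_eqI:
  fixes K :: "(real^'n) set"
  assumes "int CARD('n) simplex K"
    and "\<And>v. v \<notin> vertices K \<Longrightarrow> u v = 0"
    and "(\<Sum>v\<in>vertices K. u v) = 1" "(\<Sum>v\<in>vertices K. u v *\<^sub>R v) = x"
  shows "barycentric K x = u"
  unfolding barycentric_def
  by (rule the1_equality[OF barycentric_ex1[OF assms(1)]]) (use assms in auto)

end

theory Submission
  imports Defs
begin

text \<open>Write \<open>w = |f| f + g\<close>. Second differences of \<open>w\<close> do not see \<open>g\<close>, and those of \<open>|f| f\<close>
  control the square of the slope of \<open>f\<close>. Expanding \<open>|f| f\<close> to first order about a point splits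
  \<open>w\<close> into an affine field and a remainder that is quadratic in this slope. Hence finitely many
  values of \<open>w\<close>, taken at \<open>y\<close> and at points \<open>y + k e\<close> with \<open>e\<close> a short median vector, control the
  remainder, then the affine part, and so \<open>w\<close> on all of \<open>K\<close>. When \<open>y\<close> runs through a half-size copy
  of \<open>K\<close> about the centroid, all these points stay where the bubble is bounded below, and averaging
  over \<open>y\<close> turns the point values into integrals. All constants depend on the dimension only.\<close>

section \<open>Pointwise estimates for x -> |x| x in an inner product space\<close>

text \<open>Test the second difference \<open>D\<close> with \<open>a\<close>. The product
  \<open>a \<bullet> D\<close> is the convexity gain \<open>p + q - 2 * s\<close> of the norm,
  weighted by |a|^2, plus the nonnegative term \<open>(a \<bullet> b) * (p - q)\<close>. The gain
  controls 4 |b|^2 up to a loss of (p - q)^2, and the other term makes up for this loss.\<close>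

lemma second_difference_bound:
  fixes a b :: "'b::real_inner"
  assumes "norm b \<le> 4 * norm a"
  shows "(norm b)\<^sup>2 \<le> 3 * norm (norm (a + b) *\<^sub>R (a + b) + norm (a - b) *\<^sub>R (a - b) - 2 *\<^sub>R norm a *\<^sub>R a)"
proof (cases "a = 0")
  case True
  with assms show ?thesis by simp
next
  case False
  define p q s where "p = norm (a + b)" and "q = norm (a - b)" and "s = norm a"
  define D where "D = p *\<^sub>R (a + b) + q *\<^sub>R (a - b) - 2 *\<^sub>R s *\<^sub>R a"
  have s: "s > 0" and bs: "norm b \<le> 4 * s" using False assms by (auto simp: s_def)
  have p2: "p\<^sup>2 = s\<^sup>2 + 2 * (a \<bullet> b) + (norm b)\<^sup>2" and q2: "q\<^sup>2 = s\<^sup>2 - 2 * (a \<bullet> b) + (norm b)\<^sup>2"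
    unfolding p_def q_def s_def power2_norm_eq_inner by (simp_all add: algebra_simps inner_commute)
  have pq_lower: "2 * s \<le> p + q"
    using norm_triangle_ineq[of "a + b" "a - b"] by (simp add: p_def q_def s_def flip: scaleR_2)
  have pq_upper: "p + q \<le> 2 * s + 2 * norm b"
    using norm_triangle_ineq[of a b] norm_triangle_ineq4[of a b] by (simp add: p_def q_def s_def)
  have "\<bar>p - q\<bar> \<le> 2 * norm b"
    using norm_triangle_ineq3[of "a + b" "a - b"] by (simp add: p_def q_def flip: scaleR_2)
  then have d: "(p - q)\<^sup>2 \<le> 4 * (norm b)\<^sup>2"
    using power_mono[of "\<bar>p - q\<bar>" "2 * norm b" 2] by (simp add: power_mult_distrib)
  \<comment> \<open>A difference of squares combined with the parallelogram law. The hypothesis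
    enters through \<open>p + q + 2 * s\<close> being at most 4 |a| + 2 |b|, hence at most 12
    |a|.\<close>
  have first: "4 * (norm b)\<^sup>2 - (p - q)\<^sup>2 \<le> (p + q - 2 * s) * (12 * s)"
  proof -
    have "4 * (norm b)\<^sup>2 - (p - q)\<^sup>2 = (p + q - 2 * s) * (p + q + 2 * s)"
      using p2 q2 by (simp add: power2_eq_square algebra_simps)
    also have "\<dots> \<le> (p + q - 2 * s) * (12 * s)"
      using pq_lower pq_upper bs by (intro mult_left_mono) auto
    finally show ?thesis .
  qed
  have ab: "4 * (a \<bullet> b) = (p + q) * (p - q)"
    using p2 q2 by (simp add: power2_eq_square algebra_simps)
  \<comment> \<open>By \<open>ab\<close> the factors \<open>a \<bullet> b\<close> and
    \<open>p - q\<close> have the same sign, so their product bounds a multiple of (p - q)^2, the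
    quantity lost in \<open>first\<close>.\<close>
  have "2 * s * (p - q)\<^sup>2 \<le> (p + q) * (p - q)\<^sup>2"
    using pq_lower by (intro mult_right_mono) auto
  also have "\<dots> = 4 * (a \<bullet> b) * (p - q)"
    unfolding ab by (simp add: power2_eq_square)
  finally have second: "s * (p - q)\<^sup>2 \<le> 2 * (a \<bullet> b) * (p - q)" by (simp add: mult_ac)
  have "a \<bullet> a = s * s"
    by (simp add: s_def dot_square_norm power2_eq_square)
  then have "a \<bullet> D = s * (s * (p + q - 2 * s)) + (a \<bullet> b) * (p - q)"
    by (simp add: D_def inner_add_right inner_diff_right algebra_simps)
  moreover have "s * (4 * (norm b)\<^sup>2) - s * (p - q)\<^sup>2 \<le> 12 * (s * (s * (p + q - 2 * s)))"
    using mult_left_mono[OF first, of s] s by (simp add: algebra_simps)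
  moreover have "0 \<le> s * (p - q)\<^sup>2" using s by simp
  ultimately have "s * (4 * (norm b)\<^sup>2) \<le> 12 * (a \<bullet> D)"
    using second by linarith
  also have "\<dots> \<le> 12 * (s * norm D)"
    unfolding s_def using norm_cauchy_schwarz by auto
  finally have "s * (norm b)\<^sup>2 \<le> s * (3 * norm D)" by simp
  then show ?thesis
    using s unfolding D_def p_def q_def s_def by (rule mult_left_le_imp_le)
qed

text \<open>Close to a zero of the affine function the second difference degenerates, since
  \<open>x \<mapsto> |x| x\<close> is odd; it is then taken around the midpoint of a half-segment instead.\<close>

lemma slope_bound_by_samples:
  fixes a b c d :: "'b::real_inner"
  assumes "\<And>k. k \<in> {-1, 0, 1/2, 1} \<Longrightarrow>
      norm (norm (a + k *\<^sub>R b) *\<^sub>R (a + k *\<^sub>R b) + (c + k *\<^sub>R d)) \<le> M"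
  shows "(norm b)\<^sup>2 \<le> 48 * M"
proof -
  define w where "w k = norm (a + k *\<^sub>R b) *\<^sub>R (a + k *\<^sub>R b) + (c + k *\<^sub>R d)" for k :: real
  have M: "norm (w (-1)) \<le> M" "norm (w 0) \<le> M" "norm (w (1/2)) \<le> M" "norm (w 1) \<le> M"
    unfolding w_def by (intro assms; simp)+
  have M4: "norm (u + v - 2 *\<^sub>R x) \<le> 4 * M" if "norm u \<le> M" "norm v \<le> M" "norm x \<le> M" for u v x :: 'b
    using that norm_triangle_ineq4[of "u + v" "2 *\<^sub>R x"] norm_triangle_ineq[of u v] by simp
  show ?thesis
  proof (cases "norm b \<le> 4 * norm a")
    case True
    have "(norm b)\<^sup>2 \<le> 3 * norm (w 1 + w (-1) - 2 *\<^sub>R w 0)"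
    proof -
      have "w 1 + w (-1) - 2 *\<^sub>R w 0
          = norm (a + b) *\<^sub>R (a + b) + norm (a - b) *\<^sub>R (a - b) - 2 *\<^sub>R norm a *\<^sub>R a"
        unfolding w_def by (simp add: algebra_simps scaleR_2 scaleR_2[of c] flip: scaleR_scaleR)
      then show ?thesis using second_difference_bound[OF True] by simp
    qed
    also have "\<dots> \<le> 3 * (4 * M)" using M4 M by simp
    finally show ?thesis using M(1) norm_ge_zero[of "w (-1)"] by linarith
  next
    case False
    \<comment> \<open>Here |a| < |b| / 4 = |b'| / 2, so |a'| >= |b'| - |a| > |b'| / 2 and the second
      difference may be taken at \<open>a'\<close>. Halving the step costs a factor 4, which turns
      12 M into 48 M.\<close>
    define a' b' where "a' = a + (1/2) *\<^sub>R b" and "b' = (1/2) *\<^sub>R b"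
    have "b' = a' - a" by (simp add: a'_def b'_def)
    then have "norm b' \<le> norm a' + norm a"
      by (simp add: norm_triangle_ineq4)
    moreover have "norm b' = norm b / 2" by (simp add: b'_def)
    ultimately have "norm b' \<le> 4 * norm a'" using False norm_ge_zero[of a'] by linarith
    note second_difference_bound[OF this]
    moreover have "a' + b' = a + b" "a' - b' = a"
      by (simp_all add: a'_def b'_def flip: scaleR_add_left)
    moreover have "w 1 + w 0 - 2 *\<^sub>R w (1/2)
        = norm (a + b) *\<^sub>R (a + b) + norm a *\<^sub>R a - 2 *\<^sub>R norm a' *\<^sub>R a'"
      by (simp add: w_def a'_def scaleR_add_right[of 2] scaleR_2[of c])
    ultimately have "(norm b')\<^sup>2 \<le> 3 * norm (w 1 + w 0 - 2 *\<^sub>R w (1/2))"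
      by simp
    also have "\<dots> \<le> 3 * (4 * M)" using M4 M by simp
    finally show ?thesis by (simp add: b'_def power_divide)
  qed
qed

text \<open>For \<open>a = 0\<close> the quotient below is \<open>0\<close>, which is the correct derivative.\<close>

lemma norm_scaleR_self_taylor:
  fixes a h :: "'b::real_inner"
  shows "norm (norm (a + h) *\<^sub>R (a + h) - norm a *\<^sub>R a - (norm a *\<^sub>R h + ((a \<bullet> h) / norm a) *\<^sub>R a))
    \<le> 3 / 2 * (norm h)\<^sup>2"
proof (cases "a = 0")
  case True
  then show ?thesis by (simp add: power2_eq_square)
next
  case False
  \<comment> \<open>\<open>r\<close> is the first-order remainder of the norm itself. The product
    \<open>r * norm a\<close> is the Cauchy-Schwarz defect of \<open>a\<close> and
    \<open>a + h\<close>, which lies between 0 and |h|^2 / 2.\<close>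
  define r where "r = norm (a + h) - norm a - (a \<bullet> h) / norm a"
  have ra: "r * norm a = norm a * norm (a + h) - a \<bullet> (a + h)"
    using False by (simp add: r_def field_simps inner_add_right dot_square_norm power2_eq_square)
  have "(norm h)\<^sup>2 = (norm a)\<^sup>2 + (norm (a + h))\<^sup>2 - 2 * (a \<bullet> (a + h))"
    unfolding power2_norm_eq_inner by (simp add: algebra_simps inner_commute)
  then have "2 * (r * norm a) \<le> (norm h)\<^sup>2"
    using ra sum_squares_bound[of "norm a" "norm (a + h)"] by simp
  moreover have "0 \<le> r * norm a" using ra norm_cauchy_schwarz[of a "a + h"] by simp
  ultimately have 1: "norm (r *\<^sub>R a) \<le> (norm h)\<^sup>2 / 2"
    by (simp add: abs_mult flip: abs_mult[of _ "norm a", simplified])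
  have "\<bar>norm (a + h) - norm a\<bar> \<le> norm h"
    using norm_triangle_ineq3[of "a + h" a] by simp
  then have 2: "norm ((norm (a + h) - norm a) *\<^sub>R h) \<le> (norm h)\<^sup>2"
    by (simp add: power2_eq_square mult_right_mono)
  \<comment> \<open>Product rule: the two error terms are at most |h|^2 and |h|^2 / 2, whence
    3/2.\<close>
  have "norm (a + h) *\<^sub>R (a + h) - norm a *\<^sub>R a - (norm a *\<^sub>R h + ((a \<bullet> h) / norm a) *\<^sub>R a)
     = (norm (a + h) - norm a) *\<^sub>R h + r *\<^sub>R a"
    by (simp add: r_def algebra_simps)
  then show ?thesis
    using norm_triangle_ineq[of "(norm (a + h) - norm a) *\<^sub>R h" "r *\<^sub>R a"] 1 2 by simp
qed

text \<open>\<open>l\<close> is the derivative of \<open>w\<close> at \<open>y\<close>, and the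
  remainder \<open>R\<close> is quadratic in the increment of \<open>A\<close> and free of
  \<open>B\<close>. The samples first bound the slopes \<open>A (e v)\<close>, thereby
  \<open>R (e v)\<close>, and then \<open>l (e v)\<close> as what is left of
  \<open>w (y + e v) - w y\<close>. Linearity carries the bounds on \<open>A\<close> and
  \<open>l\<close> to combinations of the \<open>e v\<close>.\<close>

lemma pointwise_bound_by_samples:
  fixes A B :: "'a::real_vector \<Rightarrow> 'b::real_inner" and e :: "'i \<Rightarrow> 'a" and M \<rho> :: real
  assumes A: "linear A" and B: "linear B"
    and w: "\<And>x. w x = norm (c + A x) *\<^sub>R (c + A x) + (d + B x)"
    and V: "V \<noteq> {}"
    and M: "\<And>v k. v \<in> V \<Longrightarrow> k \<in> {-1, 0, 1/2, 1} \<Longrightarrow> norm (w (y + k *\<^sub>R e v)) \<le> M"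
    and r: "\<And>v. v \<in> V \<Longrightarrow> \<bar>r v\<bar> \<le> \<rho>"
  shows "norm (w (y + (\<Sum>v\<in>V. r v *\<^sub>R e v))) \<le> (1 + 74 * (card V * \<rho>) + 72 * (card V * \<rho>)\<^sup>2) * M"
proof -
  interpret A: linear A by fact
  interpret B: linear B by fact
  define a where "a = c + A y"
  define D where "D h = norm a *\<^sub>R h + ((a \<bullet> h) / norm a) *\<^sub>R a" for h
  define l where "l h = D (A h) + B h" for h
  define R where "R h = norm (a + A h) *\<^sub>R (a + A h) - norm a *\<^sub>R a - D (A h)" for h
  interpret D: linear D
    unfolding D_def
    by (intro linearI) (simp_all add: scaleR_add_right scaleR_add_left inner_add_right add_divide_distrib)
  have linear_l: "linear l"
    by (intro linearI)
      (simp_all add: l_def A.add B.add D.add A.scale B.scale D.scale scaleR_add_right add_ac)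
  have wy: "w (y + h) = w y + l h + R h" for h
    unfolding w l_def R_def a_def by (simp add: A.add B.add algebra_simps)
  have R: "norm (R h) \<le> 3/2 * (norm (A h))\<^sup>2" for h
    unfolding R_def D_def using norm_scaleR_self_taylor[of a "A h"] .
  obtain v0 where "v0 \<in> V" using V by blast
  then have M0: "norm (w y) \<le> M" using M[of v0 0] by simp
  then have "0 \<le> M" using norm_ge_zero order_trans by blast
  have r0: "0 \<le> \<rho>" using r[OF \<open>v0 \<in> V\<close>] by linarith
  have slope: "(norm (A (e v)))\<^sup>2 \<le> 48 * M" if "v \<in> V" for v
    by (rule slope_bound_by_samples[of a _ "d + B y" "B (e v)"])
      (use M[OF that] in \<open>simp add: w a_def A.add B.add A.scale B.scale algebra_simps\<close>)
  \<comment> \<open>74 = 1 + 1 + 72: two samples and the remainder, where 72 = 3/2 * 48.\<close>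
  have l_e: "norm (l (e v)) \<le> 74 * M" if "v \<in> V" for v
  proof -
    have "l (e v) = w (y + e v) - w y - R (e v)" using wy by simp
    then have "norm (l (e v)) \<le> norm (w (y + e v)) + norm (w y) + norm (R (e v))"
      using norm_triangle_ineq4[of "w (y + e v) - w y" "R (e v)"]
        norm_triangle_ineq4[of "w (y + e v)" "w y"] by simp
    then show ?thesis using M[OF that, of 1] M0 R[of "e v"] slope[OF that] by simp
  qed
  define h where "h = (\<Sum>v\<in>V. r v *\<^sub>R e v)"
  have combination: "norm (L h) \<le> card V * \<rho> * m"
    if "linear L" "\<And>v. v \<in> V \<Longrightarrow> norm (L (e v)) \<le> m" for L :: "'a \<Rightarrow> 'b" and m
  proof -
    have "norm (L h) \<le> (\<Sum>v\<in>V. \<bar>r v\<bar> * norm (L (e v)))"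
      using norm_sum[of "\<lambda>v. r v *\<^sub>R L (e v)" V]
      by (simp add: h_def linear_sum[OF that(1)] linear_cmul[OF that(1)])
    also have "\<dots> \<le> (\<Sum>v\<in>V. \<rho> * m)"
      using r that(2) r0 by (intro sum_mono mult_mono) auto
    finally show ?thesis by simp
  qed
  have "norm (l h) \<le> card V * \<rho> * (74 * M)"
    using combination[OF linear_l] l_e by blast
  moreover have "norm (R h) \<le> 72 * (card V * \<rho>)\<^sup>2 * M"
  proof -
    have "norm (A h) \<le> card V * \<rho> * sqrt (48 * M)"
      using combination[OF A] slope real_le_rsqrt by blast
    then have "(norm (A h))\<^sup>2 \<le> (card V * \<rho> * sqrt (48 * M))\<^sup>2"
      by (intro power_mono) auto
    also have "\<dots> = 48 * (card V * \<rho>)\<^sup>2 * M"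
      using \<open>0 \<le> M\<close> by (simp add: power_mult_distrib)
    finally show ?thesis using R[of h] by simp
  qed
  moreover have "norm (w (y + h)) \<le> norm (w y) + norm (l h) + norm (R h)"
    unfolding wy using norm_triangle_ineq[of "w y + l h" "R h"] norm_triangle_ineq[of "w y" "l h"] by simp
  ultimately have "norm (w (y + h)) \<le> M + card V * \<rho> * (74 * M) + 72 * (card V * \<rho>)\<^sup>2 * M"
    using M0 by linarith
  then show ?thesis unfolding h_def by (simp add: algebra_simps)
qed


section \<open>Integrals over compact sets and averaging of point samples\<close>

lemma continuous_translate_integral:
  fixes f :: "'a::euclidean_space \<Rightarrow> real"
  assumes S: "compact S" and f: "continuous_on UNIV f"
  shows "(LINT x:S|lborel. f (x + p)) = (LINT x:(+) p ` S|lborel. f x)"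
proof -
  have cS: "compact ((+) p ` S)" using S by (rule compact_translation)
  have "(LINT x:(+) p ` S|lborel. f x) = (LINT x|distr lborel borel ((+) p). indicator ((+) p ` S) x *\<^sub>R f x)"
    by (simp add: set_lebesgue_integral_def lborel_distr_plus)
  also have "\<dots> = (LINT x|lborel. indicator ((+) p ` S) (p + x) *\<^sub>R f (p + x))"
    using borel_compact[OF cS] borel_measurable_continuous_onI[OF f] by (intro integral_distr) auto
  also have "\<dots> = (LINT x:S|lborel. f (x + p))"
    unfolding set_lebesgue_integral_def
    by (intro Bochner_Integration.integral_cong) (auto split: split_indicator simp: add.commute)
  finally show ?thesis by simp
qed

text \<open>Links the completed measure in \<open>L2_norm_on\<close> with \<open>lborel\<close>, in
  which the translation argument is carried out.\<close>

lemma lebesgue_integral_eq_lborel: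
  fixes f :: "'a::euclidean_space \<Rightarrow> real"
  assumes "compact S" "continuous_on S f"
  shows "(LINT x:S|lebesgue. f x) = (LINT x:S|lborel. f x)"
  unfolding set_lebesgue_integral_def
  using borel_integrable_compact[OF assms] by (intro integral_completion) auto

lemma set_integrable_compact:
  fixes f :: "'a::euclidean_space \<Rightarrow> real"
  assumes "compact S" "continuous_on S f"
  shows "set_integrable lborel S f"
  unfolding set_integrable_def using assms by (rule borel_integrable_compact)

lemma set_integral_mono_subset:
  fixes f g :: "'a::euclidean_space \<Rightarrow> real"
  assumes "compact S" "compact T" "S \<subseteq> T" "continuous_on T f" "continuous_on T g"
    and "\<And>x. x \<in> S \<Longrightarrow> f x \<le> g x" "\<And>x. x \<in> T \<Longrightarrow> 0 \<le> g x"
  shows "(LINT x:S|lborel. f x) \<le> (LINT x:T|lborel. g x)"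
proof -
  have "continuous_on S f" using assms continuous_on_subset by blast
  then show ?thesis
    unfolding set_lebesgue_integral_def
    using assms by (intro integral_mono borel_integrable_compact) (auto split: split_indicator)
qed

text \<open>The sampling inequality is integrated over \<open>y\<close> before it is integrated over \<open>x\<close>, which replaces
  point values by integrals over translates of \<open>S\<close>.\<close>

lemma integral_le_of_sampling:
  fixes W b :: "'a::euclidean_space \<Rightarrow> real" and p :: "'i \<Rightarrow> 'a"
  assumes K: "compact K" and S: "compact S" and \<sigma>: "0 < \<sigma>" "measure lborel S = \<sigma> * measure lborel K"
    and W: "continuous_on UNIV W" "\<And>x. 0 \<le> W x"
    and b: "continuous_on UNIV b" "\<And>x. x \<in> K \<Longrightarrow> 0 \<le> b x"
    and I: "finite I"
    and sub: "\<And>i y. i \<in> I \<Longrightarrow> y \<in> S \<Longrightarrow> y + p i \<in> K \<and> \<beta> \<le> b (y + p i)" and \<beta>: "0 < \<beta>"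
    and c: "0 \<le> c"
    and le: "\<And>x y. x \<in> K \<Longrightarrow> y \<in> S \<Longrightarrow> W x \<le> c * (\<Sum>i\<in>I. W (y + p i))"
  shows "(LINT x:K|lborel. W x) \<le> c * card I / (\<beta> * \<sigma>) * (LINT x:K|lborel. b x * W x)"
proof -
  define J where "J = (LINT x:K|lborel. b x * W x)"
  define m where "m = measure lborel K"
  have cont: "continuous_on X W" "continuous_on X b" for X
    using W(1) b(1) continuous_on_subset by blast+
  have fin: "emeasure lborel K < \<infinity>" "emeasure lborel S < \<infinity>"
    using K S emeasure_compact_finite by blast+
  have J0: "0 \<le> J"
    unfolding J_def set_lebesgue_integral_def
    using W(2) b(2) by (intro integral_nonneg_AE) (auto split: split_indicator)
  \<comment> \<open>The translate of \<open>S\<close> by \<open>p i\<close> stays in the part of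
    \<open>K\<close> where \<open>b\<close> is at least \<open>\<beta>\<close>, so inserting the
    weight costs only a factor 1 / \<open>\<beta>\<close>.\<close>
  have translate: "(LINT y:S|lborel. W (y + p i)) \<le> J / \<beta>" if "i \<in> I" for i
  proof -
    have "(LINT y:S|lborel. W (y + p i)) = (LINT x:(+) (p i) ` S|lborel. W x)"
      using S W(1) by (rule continuous_translate_integral)
    also have "\<dots> \<le> (LINT x:K|lborel. b x * W x / \<beta>)"
    proof (rule set_integral_mono_subset)
      show "compact ((+) (p i) ` S)" using S by (rule compact_translation)
      show "(+) (p i) ` S \<subseteq> K" using sub[OF that] by (auto simp: add.commute)
      show "W x \<le> b x * W x / \<beta>" if x: "x \<in> (+) (p i) ` S" for x
        using mult_right_mono[OF _ W(2), of \<beta> "b x" x] sub[OF \<open>i \<in> I\<close>] x \<beta>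
        by (auto simp: field_simps)
    qed (use K W b \<beta> cont in \<open>auto intro!: continuous_intros\<close>)
    also have "\<dots> = J / \<beta>" by (simp add: J_def)
    finally show ?thesis .
  qed
  have contp: "continuous_on X (\<lambda>y. W (y + p i))" for X i
    by (rule continuous_on_compose2[OF W(1)]) (auto intro!: continuous_intros)
  \<comment> \<open>Integrate the sampling inequality over \<open>y\<close> with \<open>x\<close>
    fixed: the left side picks up the measure of \<open>S\<close>, which is
    \<open>\<sigma> * m\<close>.\<close>
  have pointwise: "\<sigma> * m * W x \<le> c * card I * (J / \<beta>)" if "x \<in> K" for x
  proof -
    have "\<sigma> * m * W x = (LINT y:S|lborel. W x)"
      using fin(2) borel_compact[OF S] \<sigma>(2)
      by (simp add: m_def set_integral_const)
    also have "\<dots> \<le> (LINT y:S|lborel. c * (\<Sum>i\<in>I. W (y + p i)))"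
      using S le[OF that] contp
      by (intro set_integral_mono set_integrable_compact continuous_intros) auto
    also have "\<dots> = c * (\<Sum>i\<in>I. LINT y:S|lborel. W (y + p i))"
      using set_integrable_compact[OF S contp]
      by (simp add: set_lebesgue_integral_def set_integrable_def sum_distrib_left mult.left_commute
          flip: integral_sum)
    also have "\<dots> \<le> c * (\<Sum>i\<in>I. J / \<beta>)"
      using c translate by (intro mult_left_mono sum_mono) auto
    finally show ?thesis by simp
  qed
  show ?thesis
  proof (cases "m = 0")
    \<comment> \<open>A null set is treated separately, since the other case divides by
      \<open>m\<close>.\<close>
    case True
    then have "K \<in> null_sets lborel"
      using fin(1) borel_compact[OF K] by (auto simp: m_def null_sets_def measure_def enn2real_eq_0_iff)
    then have "(LINT x:K|lborel. W x) = 0"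
      unfolding set_lebesgue_integral_def
      by (intro integral_eq_zero_AE) (auto dest: AE_not_in elim!: eventually_mono)
    then show ?thesis using J0 c \<beta> \<sigma>(1) by (simp flip: J_def)
  next
    case False
    then have m: "0 < m" unfolding m_def by (simp add: zero_less_measure_iff less_le)
    \<comment> \<open>Integrating over \<open>x\<close> produces a factor \<open>m\<close> that
      cancels the one in the denominator; hence the constant does not see the size of
      \<open>K\<close>.\<close>
    have "(LINT x:K|lborel. W x) \<le> (LINT x:K|lborel. c * card I * (J / \<beta>) / (\<sigma> * m))"
    proof (intro set_integral_mono set_integrable_compact K cont continuous_on_const)
      show "W x \<le> c * card I * (J / \<beta>) / (\<sigma> * m)" if "x \<in> K" for x
        using pointwise[OF that] m \<sigma>(1) by (subst pos_le_divide_eq) (auto simp: mult_ac)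
    qed
    also have "\<dots> = m * (c * card I * (J / \<beta>) / (\<sigma> * m))"
      using fin(1) borel_compact[OF K] by (simp add: m_def set_integral_const)
    finally show ?thesis using m \<sigma>(1) \<beta> by (simp add: J_def field_simps)
  qed
qed

section \<open>Affine fields, barycentric coordinates and the bubble\<close>

text \<open>\<open>P1_vec\<close> restricts a field on \<open>K\<close> only. The globally affine
  representative obtained here is continuous on the whole space, as the averaging lemma
  requires.\<close>

lemma P1_vecE:
  assumes "f \<in> P1_vec (K :: (real^'n) set)"
  obtains c A where "linear A" "\<And>x. x \<in> K \<Longrightarrow> f x = c + A x"
proof -
  have "\<forall>i. \<exists>c a. \<forall>x\<in>K. f x $ i = c + (\<Sum>j\<in>UNIV. a j * x $ j)"
    using assms by (simp add: P1_vec_def P1_def)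
  then obtain c a where ca: "\<And>i x. x \<in> K \<Longrightarrow> f x $ i = c i + (\<Sum>j\<in>UNIV. a i j * x $ j)"
    by metis
  show thesis
  proof
    show "linear (\<lambda>x. (\<chi> i j. a i j) *v x)" by (rule matrix_vector_mul_linear)
    show "f x = (\<chi> i. c i) + (\<chi> i j. a i j) *v x" if "x \<in> K" for x
      by (simp add: vec_eq_iff ca[OF that] matrix_vector_mult_def)
  qed
qed

definition centroid :: "'a::real_vector set \<Rightarrow> 'a"
  where "centroid K = (\<Sum>v\<in>vertices K. (1 / card (vertices K)) *\<^sub>R v)"

context
  fixes K :: "(real^'n) set"
  assumes simplex: "int CARD('n) simplex K"
begin

lemma barycentric_properties:
  "v \<notin> vertices K \<Longrightarrow> barycentric K x v = 0"
  "(\<Sum>v\<in>vertices K. barycentric K x v) = 1"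
  "(\<Sum>v\<in>vertices K. barycentric K x v *\<^sub>R v) = x"
  using theI'[OF barycentric_ex1[OF simplex, of x]] unfolding barycentric_def by auto

lemma barycentric_eq_on_vertices:
  assumes "(\<Sum>v\<in>vertices K. u v) = 1" "(\<Sum>v\<in>vertices K. u v *\<^sub>R v) = x" "v \<in> vertices K"
  shows "barycentric K x v = u v"
proof -
  have "barycentric K x = (\<lambda>v. if v \<in> vertices K then u v else 0)"
    using assms by (intro barycentric_eqI[OF simplex]) auto
  with assms(3) show ?thesis by simp
qed

text \<open>By uniqueness of the weights, coordinates respect affine combinations. Three points
  suffice: \<open>x + y\<close> is the affine combination of \<open>x\<close>, \<open>y\<close> and
  0 with weights 1, 1, -1, so subtracting the value at 0 leaves a linear map.\<close>

lemma continuous_on_barycentric: "continuous_on X (\<lambda>x. barycentric K x v)"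
proof (cases "v \<in> vertices K")
  case True
  let ?b = "barycentric K"
  have affine: "?b (r *\<^sub>R x + s *\<^sub>R y + t *\<^sub>R z) v = r * ?b x v + s * ?b y v + t * ?b z v"
    if "r + s + t = 1" for r s t x y z
    using True that
    by (intro barycentric_eq_on_vertices)
      (simp_all add: sum.distrib scaleR_add_left barycentric_properties
        flip: sum_distrib_left scaleR_scaleR scaleR_sum_right)
  have "linear (\<lambda>x. ?b x v - ?b 0 v)"
  proof (rule linearI)
    show "?b (x + y) v - ?b 0 v = (?b x v - ?b 0 v) + (?b y v - ?b 0 v)" for x y
      using affine[of 1 1 "-1" x y 0] by simp
    show "?b (r *\<^sub>R x) v - ?b 0 v = r *\<^sub>R (?b x v - ?b 0 v)" for r x
      using affine[of r "1 - r" 0 x 0 0] by (simp add: algebra_simps)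
  qed
  then have "continuous_on X (\<lambda>x. ?b x v - ?b 0 v)"
    by (simp add: linear_continuous_on linear_conv_bounded_linear)
  from continuous_on_add[OF this continuous_on_const[of _ "?b 0 v"]]
  show ?thesis by (simp only: diff_add_cancel)
qed (simp add: barycentric_properties)

lemma continuous_on_bubble: "continuous_on X (bubble K)"
  unfolding bubble_def by (intro continuous_intros continuous_on_barycentric)

lemma compact_simplex: "compact K"
  using simplex_vertices[OF simplex] compact_convex_hull finite_imp_compact by metis

lemma barycentric_nonneg: "x \<in> K \<Longrightarrow> v \<in> vertices K \<Longrightarrow> 0 \<le> barycentric K x v"
proof -
  assume "x \<in> K" "v \<in> vertices K"
  then have "x \<in> convex hull (vertices K)" using simplex_vertices(4)[OF simplex] by simp
  then obtain u where "\<forall>v\<in>vertices K. 0 \<le> u v" "sum u (vertices K) = 1"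
    "(\<Sum>v\<in>vertices K. u v *\<^sub>R v) = x"
    unfolding convex_hull_finite[OF simplex_vertices(1)[OF simplex]] by blast
  with \<open>v \<in> vertices K\<close> show ?thesis using barycentric_eq_on_vertices by metis
qed

lemma bubble_nonneg: "x \<in> K \<Longrightarrow> 0 \<le> bubble K x"
  unfolding bubble_def by (intro mult_nonneg_nonneg prod_nonneg barycentric_nonneg) auto

text \<open>All coordinates of the centroid are 1 / (d + 1). If each coordinate keeps the fraction
  \<open>\<delta>\<close> of this value, the normalising factor (d + 1)^(d + 1) of the bubble
  cancels and leaves a power of \<open>\<delta>\<close>.\<close>

lemma bubble_lower_bound:
  assumes "(\<Sum>v\<in>vertices K. u v) = 1" "(\<Sum>v\<in>vertices K. u v *\<^sub>R v) = x"
    and "\<And>v. v \<in> vertices K \<Longrightarrow> \<delta> / card (vertices K) \<le> u v" and "0 \<le> \<delta>"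
  shows "x \<in> K" "\<delta> ^ (CARD('n) + 1) \<le> bubble K x"
proof -
  note V = simplex_vertices[OF simplex]
  have nonneg: "0 \<le> u v" if "v \<in> vertices K" for v
    using assms(3)[OF that] assms(4) by (meson divide_nonneg_nonneg of_nat_0_le_iff order_trans)
  then have "x \<in> convex hull (vertices K)"
    unfolding convex_hull_finite[OF V(1)] using assms(1,2) by blast
  then show "x \<in> K" using V(4) by simp
  have "(\<Prod>v\<in>vertices K. \<delta> / card (vertices K)) \<le> (\<Prod>v\<in>vertices K. barycentric K x v)"
    using assms barycentric_eq_on_vertices[OF assms(1,2)] by (intro prod_mono) auto
  then have "(\<delta> / real (CARD('n) + 1)) ^ (CARD('n) + 1) \<le> (\<Prod>v\<in>vertices K. barycentric K x v)"
    using V(2) by simp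
  then show "\<delta> ^ (CARD('n) + 1) \<le> bubble K x"
    unfolding bubble_def power_divide by (subst (asm) pos_divide_le_eq) (auto simp: mult.commute)
qed

section \<open>The half-size copy of the simplex and its median directions\<close>

text \<open>With N vertices, the coordinates of \<open>y\<close> are at least 1 / (2 N), half of
  those of the centroid. The step \<open>e\<close> is the median divided by 4 N, so it changes each
  coordinate by at most 1 / (4 N), and at least 1 / (4 N) remains.\<close>

lemma shifted_half_simplex:
  fixes x :: "real^'n"
  assumes x: "x \<in> K" and v: "v \<in> vertices K" and k: "\<bar>k\<bar> \<le> 1"
  defines "y \<equiv> (1/2) *\<^sub>R x + (1/2) *\<^sub>R centroid K"
    and "e \<equiv> (1 / (4 * card (vertices K))) *\<^sub>R (v - centroid K)"
  shows "y + k *\<^sub>R e \<in> K" "(1/4) ^ (CARD('n) + 1) \<le> bubble K (y + k *\<^sub>R e)"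
proof -
  note V = simplex_vertices[OF simplex]
  let ?V = "vertices K"
  define N where "N = real (card ?V)"
  have N: "1 \<le> N" using V(2) by (simp add: N_def)
  define t where "t = k / (4 * N)"
  \<comment> \<open>Weights of \<open>y + k *\<^sub>R e\<close>: half of those of \<open>x\<close>,
    with \<open>t\<close> moved from the centroid to \<open>v\<close>.\<close>
  define u where
    "u w = (1/2) * barycentric K x w + (1/2 - t) * (1 / N) + t * (if w = v then 1 else 0)" for w
  have sum_N: "(\<Sum>w\<in>?V. 1 / N) = 1" using N by (simp add: N_def)
  have "sum u ?V = (1/2) * (\<Sum>w\<in>?V. barycentric K x w) + (1/2 - t) * (\<Sum>w\<in>?V. 1 / N)
      + t * (\<Sum>w\<in>?V. if w = v then 1 else 0)"
    unfolding u_def sum.distrib sum_distrib_left ..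
  then have sum_u: "sum u ?V = 1"
    unfolding sum_N barycentric_properties(2) using v V(1) by simp
  have u_x: "(\<Sum>w\<in>?V. u w *\<^sub>R w) = y + k *\<^sub>R e"
  proof -
    have "(\<Sum>w\<in>?V. u w *\<^sub>R w) = (1/2) *\<^sub>R (\<Sum>w\<in>?V. barycentric K x w *\<^sub>R w)
        + (1/2 - t) *\<^sub>R (\<Sum>w\<in>?V. (1 / N) *\<^sub>R w) + t *\<^sub>R (\<Sum>w\<in>?V. (if w = v then 1 else 0) *\<^sub>R w)"
      unfolding u_def scaleR_sum_right by (simp add: scaleR_add_left sum.distrib)
    also have "(\<Sum>w\<in>?V. (if w = v then 1 else 0) *\<^sub>R w) = v"
      using v V(1) by (simp add: if_distrib[of "\<lambda>r. r *\<^sub>R _"] cong: if_cong)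
    also have "(\<Sum>w\<in>?V. (1 / N) *\<^sub>R w) = centroid K" by (simp add: N_def centroid_def)
    finally have "(\<Sum>w\<in>?V. u w *\<^sub>R w) = (1/2) *\<^sub>R x + (1/2 - t) *\<^sub>R centroid K + t *\<^sub>R v"
      unfolding barycentric_properties(3) .
    also have "\<dots> = y + t *\<^sub>R (v - centroid K)"
      unfolding y_def by (simp only: scaleR_diff_left scaleR_diff_right) simp
    also have "t *\<^sub>R (v - centroid K) = k *\<^sub>R e"
      by (simp add: t_def e_def N_def)
    finally show ?thesis .
  qed
  have u_lower: "(1/4) / N \<le> u w" if "w \<in> ?V" for w
  proof -
    \<comment> \<open>\<open>q\<close> is the \<open>w\<close>-coordinate of the median
      \<open>v - centroid K\<close>.\<close>
    define q where "q = (if w = v then 1 else 0) - 1 / N"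
    have "\<bar>q\<bar> \<le> 1" using N by (simp add: q_def)
    then have "\<bar>k * q\<bar> \<le> 1" using k by (simp add: abs_mult mult_le_one)
    then have "- 1 / (4 * N) \<le> k * q / (4 * N)" using N by (intro divide_right_mono) auto
    moreover have "u w = (1/2) * barycentric K x w + 1 / (2 * N) + k * q / (4 * N)"
      by (simp add: u_def t_def q_def algebra_simps diff_divide_distrib)
    moreover have "- 1 / (4 * N) + 1 / (2 * N) = (1/4) / N" using N by (simp add: field_simps)
    ultimately show ?thesis using barycentric_nonneg[OF x that] by linarith
  qed
  show "y + k *\<^sub>R e \<in> K" "(1/4) ^ (CARD('n) + 1) \<le> bubble K (y + k *\<^sub>R e)"
    using bubble_lower_bound[OF sum_u u_x, of "1/4"] u_lower unfolding N_def by simp_all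
qed

text \<open>Supplies the coefficients for \<open>pointwise_bound_by_samples\<close>. Differences of
  barycentric coordinates serve as weights of the medians; the factor 4 N in the bound undoes the
  shortening of the medians.\<close>

lemma diff_as_median_combination:
  fixes x x' :: "real^'n"
  assumes x: "x \<in> K" and x': "x' \<in> K"
  obtains r :: "real^'n \<Rightarrow> real" where "\<And>v. v \<in> vertices K \<Longrightarrow> \<bar>r v\<bar> \<le> 4 * real (card (vertices K))"
    "x = (1/2) *\<^sub>R x' + (1/2) *\<^sub>R centroid K
      + (\<Sum>v\<in>vertices K. r v *\<^sub>R (1 / (4 * card (vertices K))) *\<^sub>R (v - centroid K))"
proof
  note V = simplex_vertices[OF simplex]
  let ?V = "vertices K"
  define N where "N = real (card ?V)"
  have N: "0 < N" using V(2) by (simp add: N_def)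
  have b_le: "barycentric K z v \<le> 1" if "z \<in> K" "v \<in> ?V" for z v
    using member_le_sum[of v ?V "barycentric K z"] barycentric_nonneg[OF that(1)] that(2) V(1)
    by (simp add: barycentric_properties)
  define r where "r v = 4 * N * (barycentric K x v - (1/2) * barycentric K x' v)" for v
  show "\<bar>r v\<bar> \<le> 4 * real (card ?V)" if v: "v \<in> ?V" for v
  proof -
    have "\<bar>barycentric K x v - (1/2) * barycentric K x' v\<bar> \<le> 1"
      using b_le[OF x v] b_le[OF x' v] barycentric_nonneg[OF x v] barycentric_nonneg[OF x' v]
      by linarith
    then show ?thesis using N by (simp add: r_def abs_mult N_def)
  qed
  \<comment> \<open>The weights sum to 1, so the centroid can be pulled out of the sum.\<close>
  have combination: "(\<Sum>v\<in>?V. barycentric K z v *\<^sub>R (v - centroid K)) = z - centroid K" for z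
    by (simp add: scaleR_diff_right sum_subtractf barycentric_properties flip: scaleR_sum_left)
  have "(\<Sum>v\<in>?V. r v *\<^sub>R (1 / (4 * card ?V)) *\<^sub>R (v - centroid K))
    = (\<Sum>v\<in>?V. barycentric K x v *\<^sub>R (v - centroid K))
      - (1/2) *\<^sub>R (\<Sum>v\<in>?V. barycentric K x' v *\<^sub>R (v - centroid K))"
    unfolding scaleR_sum_right sum_subtractf[symmetric]
    using N by (intro sum.cong) (simp_all add: r_def N_def scaleR_diff_left)
  also have "\<dots> = (x - centroid K) - (1/2) *\<^sub>R (x' - centroid K)"
    unfolding combination ..
  finally show "x = (1/2) *\<^sub>R x' + (1/2) *\<^sub>R centroid K
      + (\<Sum>v\<in>?V. r v *\<^sub>R (1 / (4 * card ?V)) *\<^sub>R (v - centroid K))"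
    by (simp add: scaleR_diff_right vec_eq_iff)
qed

section \<open>The weighted estimate on a simplex\<close>

text \<open>Origin of the constants: 4 N^2 is the number N of vertices times the coefficient bound 4
  N, the factor 4 N counts the samples (four for each vertex), and the denominator is the lower
  bound of the bubble times the volume ratio of the half-size copy.\<close>

lemma bubble_weighted_integral_bound:
  fixes w :: "real^'n \<Rightarrow> real^'n"
  assumes A: "linear A" and B: "linear B"
    and w: "\<And>x. w x = norm (c + A x) *\<^sub>R (c + A x) + (d + B x)"
  defines "N \<equiv> real (CARD('n) + 1)"
  shows "(LINT x:K|lborel. (norm (w x))\<^sup>2)
    \<le> (1 + 74 * (4 * N\<^sup>2) + 72 * (4 * N\<^sup>2)\<^sup>2)\<^sup>2 * (4 * N) / ((1/4) ^ (CARD('n) + 1) * (1/2) ^ CARD('n))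
      * (LINT x:K|lborel. bubble K x * (norm (w x))\<^sup>2)"
proof -
  note V = simplex_vertices[OF simplex]
  let ?V = "vertices K" and ?Q = "{-1, 0, 1/2, 1} :: real set"
  have N: "N = real (card ?V)" using V(2) by (simp add: N_def)
  define e where "e v = (1 / (4 * card ?V)) *\<^sub>R (v - centroid K)" for v
  define S where "S = (\<lambda>x. (1/2) *\<^sub>R x + (1/2) *\<^sub>R centroid K) ` K"
  define p where "p = (\<lambda>(v, k). k *\<^sub>R e v)"
  have V_ne: "?V \<noteq> {}" using V(2) by auto
  have card_I: "real (card (?V \<times> ?Q)) = 4 * N" by (simp add: card_cartesian_product N)
  have cont_w: "continuous_on UNIV w"
    unfolding w using A B
    by (intro continuous_intros linear_continuous_on) (simp_all add: linear_conv_bounded_linear)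
  have compact_S: "compact S"
    unfolding S_def by (intro compact_continuous_image continuous_intros compact_simplex)
  have measure_S: "measure lborel S = (1/2) ^ CARD('n) * measure lborel K"
    using measure_lebesgue_affine[of "1/2" "(1/2) *\<^sub>R centroid K" K]
      borel_compact[OF compact_S] borel_compact[OF compact_simplex]
    unfolding S_def by simp
  have "(LINT x:K|lborel. (norm (w x))\<^sup>2)
    \<le> (1 + 74 * (4 * N\<^sup>2) + 72 * (4 * N\<^sup>2)\<^sup>2)\<^sup>2 * card (?V \<times> ?Q) / ((1/4) ^ (CARD('n) + 1) * (1/2) ^ CARD('n))
      * (LINT x:K|lborel. bubble K x * (norm (w x))\<^sup>2)"
  proof (rule integral_le_of_sampling[OF compact_simplex compact_S _ measure_S])
    show "y + p i \<in> K \<and> (1/4) ^ (CARD('n) + 1) \<le> bubble K (y + p i)"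
      if "i \<in> ?V \<times> ?Q" "y \<in> S" for i y
    proof -
      obtain v k where i: "i = (v, k)" "v \<in> ?V" and "k \<in> ?Q" using \<open>i \<in> ?V \<times> ?Q\<close> by blast
      then have k: "\<bar>k\<bar> \<le> 1" by auto
      obtain x where "x \<in> K" "y = (1/2) *\<^sub>R x + (1/2) *\<^sub>R centroid K"
        using \<open>y \<in> S\<close> unfolding S_def by blast
      with shifted_half_simplex[OF _ i(2) k] show ?thesis
        unfolding i(1) p_def e_def by simp
    qed
    show "(norm (w x))\<^sup>2 \<le> (1 + 74 * (4 * N\<^sup>2) + 72 * (4 * N\<^sup>2)\<^sup>2)\<^sup>2 * (\<Sum>i\<in>?V \<times> ?Q. (norm (w (y + p i)))\<^sup>2)"
      if "x \<in> K" "y \<in> S" for x y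
    proof -
      \<comment> \<open>The sum of squares dominates every single sample, so \<open>sqrt M2\<close>
        can serve as the pointwise bound \<open>M\<close>. Squaring the result gives the form that
        is integrated.\<close>
      define M2 where "M2 = (\<Sum>i\<in>?V \<times> ?Q. (norm (w (y + p i)))\<^sup>2)"
      have M2: "0 \<le> M2" unfolding M2_def by (intro sum_nonneg) auto
      obtain x' where x': "x' \<in> K" "y = (1/2) *\<^sub>R x' + (1/2) *\<^sub>R centroid K"
        using \<open>y \<in> S\<close> unfolding S_def by blast
      obtain r where r: "\<And>v. v \<in> ?V \<Longrightarrow> \<bar>r v\<bar> \<le> 4 * real (card ?V)" "x = y + (\<Sum>v\<in>?V. r v *\<^sub>R e v)"
        by (rule diff_as_median_combination[OF \<open>x \<in> K\<close> x'(1), folded x'(2) e_def]) (rule that)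
      have M: "norm (w (y + k *\<^sub>R e v)) \<le> sqrt M2" if "v \<in> ?V" "k \<in> ?Q" for v k
      proof (rule real_le_rsqrt)
        show "(norm (w (y + k *\<^sub>R e v)))\<^sup>2 \<le> M2"
          using member_le_sum[of "(v, k)" "?V \<times> ?Q" "\<lambda>i. (norm (w (y + p i)))\<^sup>2"] that V(1)
          by (simp add: M2_def p_def)
      qed
      have "norm (w x) \<le> (1 + 74 * (card ?V * (4 * real (card ?V)))
          + 72 * (card ?V * (4 * real (card ?V)))\<^sup>2) * sqrt M2"
        unfolding r(2) by (rule pointwise_bound_by_samples[OF A B w V_ne M r(1)])
      also have "card ?V * (4 * real (card ?V)) = 4 * N\<^sup>2"
        by (simp add: N power2_eq_square)
      finally have "(norm (w x))\<^sup>2 \<le> ((1 + 74 * (4 * N\<^sup>2) + 72 * (4 * N\<^sup>2)\<^sup>2) * sqrt M2)\<^sup>2"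
        by (intro power_mono) auto
      then show ?thesis using M2 by (simp add: power_mult_distrib M2_def)
    qed
  qed (use V(1) cont_w bubble_nonneg in \<open>auto intro!: continuous_intros continuous_on_bubble\<close>)
  then show ?thesis unfolding card_I .
qed

text \<open>On \<open>K\<close> the fields agree with affine ones and the bubble is nonnegative, so
  the square root in the weight disappears upon squaring, and the integral bound applies.\<close>

lemma L2_norm_on_bubble_bound:
  assumes f: "f \<in> P1_vec K" and g: "g \<in> P1_vec K"
  defines "N \<equiv> real (CARD('n) + 1)"
  shows "L2_norm_on K (\<lambda>x. norm (f x) *\<^sub>R f x + g x)
    \<le> sqrt ((1 + 74 * (4 * N\<^sup>2) + 72 * (4 * N\<^sup>2)\<^sup>2)\<^sup>2 * (4 * N) / ((1/4) ^ (CARD('n) + 1) * (1/2) ^ CARD('n)))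
      * L2_norm_on K (\<lambda>x. sqrt (bubble K x) *\<^sub>R (norm (f x) *\<^sub>R f x + g x))"
proof -
  obtain c A where A: "linear A" "\<And>x. x \<in> K \<Longrightarrow> f x = c + A x" using P1_vecE[OF f] by blast
  obtain d B where B: "linear B" "\<And>x. x \<in> K \<Longrightarrow> g x = d + B x" using P1_vecE[OF g] by blast
  define w where "w x = norm (c + A x) *\<^sub>R (c + A x) + (d + B x)" for x
  have cont_w: "continuous_on K w"
    unfolding w_def using A(1) B(1)
    by (intro continuous_intros linear_continuous_on) (simp_all add: linear_conv_bounded_linear)
  have K: "K \<in> sets lebesgue" using borel_compact[OF compact_simplex] by simp
  have "(LINT x:K|lebesgue. (norm (norm (f x) *\<^sub>R f x + g x))\<^sup>2) = (LINT x:K|lebesgue. (norm (w x))\<^sup>2)"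
    using A(2) B(2) K by (intro set_lebesgue_integral_cong) (auto simp: w_def)
  also have "\<dots> = (LINT x:K|lborel. (norm (w x))\<^sup>2)"
    by (intro lebesgue_integral_eq_lborel compact_simplex continuous_intros cont_w)
  finally have L: "(LINT x:K|lebesgue. (norm (norm (f x) *\<^sub>R f x + g x))\<^sup>2)
    = (LINT x:K|lborel. (norm (w x))\<^sup>2)" .
  have "(LINT x:K|lebesgue. (norm (sqrt (bubble K x) *\<^sub>R (norm (f x) *\<^sub>R f x + g x)))\<^sup>2)
      = (LINT x:K|lebesgue. bubble K x * (norm (w x))\<^sup>2)"
    using A(2) B(2) K bubble_nonneg
    by (intro set_lebesgue_integral_cong) (auto simp: w_def power_mult_distrib)
  also have "\<dots> = (LINT x:K|lborel. bubble K x * (norm (w x))\<^sup>2)"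
    by (intro lebesgue_integral_eq_lborel compact_simplex continuous_intros cont_w continuous_on_bubble)
  finally have R: "(LINT x:K|lebesgue. (norm (sqrt (bubble K x) *\<^sub>R (norm (f x) *\<^sub>R f x + g x)))\<^sup>2)
    = (LINT x:K|lborel. bubble K x * (norm (w x))\<^sup>2)" .
  show ?thesis
    unfolding L2_norm_on_def L R real_sqrt_mult[symmetric] real_sqrt_le_iff N_def
    by (rule bubble_weighted_integral_bound[OF A(1) B(1) w_def])
qed

end

theorem lemmaA1:
  assumes "CARD('n::finite) \<in> {2, 3}"
  shows "\<exists>Ceq>0. \<forall>(K :: (real^'n) set) f g.
    int CARD('n) simplex K \<longrightarrow> f \<in> P1_vec K \<longrightarrow> g \<in> P1_vec K \<longrightarrow>
    L2_norm_on K (\<lambda>x. norm (f x) *\<^sub>R f x + g x)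
      \<le> Ceq * L2_norm_on K (\<lambda>x. sqrt (bubble K x) *\<^sub>R (norm (f x) *\<^sub>R f x + g x))"
proof (intro exI conjI allI impI)
  let ?N = "real (CARD('n) + 1)"
  have "0 < 1 + 74 * (4 * ?N\<^sup>2) + 72 * (4 * ?N\<^sup>2)\<^sup>2"
    by (intro add_pos_nonneg) auto
  \<comment> \<open>This fixes the witness left open by \<open>exI\<close>. It is built from
    \<open>CARD('n)\<close> alone, hence uniform in the simplex and in both fields.\<close>
  then show "0 < sqrt ((1 + 74 * (4 * ?N\<^sup>2) + 72 * (4 * ?N\<^sup>2)\<^sup>2)\<^sup>2 * (4 * ?N)
      / ((1/4) ^ (CARD('n) + 1) * (1/2) ^ CARD('n)))"
    by (intro real_sqrt_gt_zero divide_pos_pos mult_pos_pos zero_less_power) auto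
qed (rule L2_norm_on_bubble_bound)

end
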